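(* Let $n\ge 1$ and let $a_i$ and $b_i$ $(i=1,\dots,n)$ be real numbers such that $0\le a_1\le\cdots\le a_n$, $0\le b_1\le\cdots\le b_n$, and $\sum_{i=1}^k a_i\le\sum_{i=1}^k b_i$ for $k=1,\dots,n$. Let $f:(0,+\infty)\to\mathbb{R}$ be a function such that $f''$ is completely monotonic on $(0,+\infty)$. Then the function $$x\mapsto \exp\Big(\sum_{i=1}^n\big(f(x+a_i)-f(x+b_i)\big)\Big)$$ is logarithmically completely monotonic on $(0,+\infty)$.
   Context: A function $g$ is completely monotonic on an interval $(a,b)$ if it has derivatives of all orders there and $(-1)^kg^{(k)}(x)\ge 0$ for all $x\in(a,b)$ and all integers $k\ge 0$. A positive function $g$ is logarithmically completely monotonic on an interval if $g=e^{-h}$ with $h'$ completely monotonic on that interval. *)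

theory Defs
  imports "HOL-Analysis.Analysis"
begin

text \<open>The set \<open>S\<close> is meant to be an open interval, possibly unbounded. As \<open>S\<close> is open, the
  iterated derivatives at points of \<open>S\<close> depend only on the values of \<open>g\<close> on \<open>S\<close>, so a function
  \<open>(0, \<infinity>) \<rightarrow> \<real>\<close> may be represented by any total function extending it. The operator
  \<^const>\<open>deriv\<close> returns an unspecified value where no derivative exists, hence
  differentiability is always required explicitly.\<close>

definition completely_monotonic_on :: "real set \<Rightarrow> (real \<Rightarrow> real) \<Rightarrow> bool" where
  "completely_monotonic_on S g \<longleftrightarrow>
     (\<forall>k. \<forall>x\<in>S. (deriv ^^ k) g differentiable (at x)) \<and>
     (\<forall>k. \<forall>x\<in>S. (- 1) ^ k * (deriv ^^ k) g x \<ge> 0)"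

definition log_completely_monotonic_on :: "real set \<Rightarrow> (real \<Rightarrow> real) \<Rightarrow> bool" where
  "log_completely_monotonic_on S g \<longleftrightarrow>
     (\<forall>x\<in>S. g x > 0) \<and>
     (\<exists>h. (\<forall>x\<in>S. g x = exp (- h x)) \<and>
          (\<forall>x\<in>S. h differentiable (at x)) \<and>
          completely_monotonic_on S (deriv h))"

end

theory Submission
  imports Defs
begin

text \<open>Put \<open>h x = (\<Sum>i. f (x + b i) - f (x + a i))\<close>. Complete monotonicity of \<open>h'\<close> at order \<open>k\<close> says
  \<open>\<Sum>i. \<phi> (x + a i) \<le> \<Sum>i. \<phi> (x + b i)\<close> for \<open>\<phi> = (-1)\<^sup>k f\<^sup>(\<^sup>k\<^sup>+\<^sup>1\<^sup>)\<close>, which is increasing and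
  concave because \<open>f''\<close> is completely monotonic. Such weak majorization inequalities follow from
  the tangent-line bound \<open>\<phi> (x + b i) - \<phi> (x + a i) \<ge> \<phi>' (x + b i) (b i - a i)\<close> by Abel summation,
  since the weights \<open>\<phi>' (x + b i)\<close> are nonnegative and decrease with \<open>i\<close>.\<close>

text \<open>Abel summation in inductive form: lowering the coefficient of the nonnegative partial
  sum up to \<open>n\<close> from \<open>c n\<close> to \<open>c (Suc n)\<close> can only decrease
  the product, and the new term \<open>c (Suc n) * d (Suc n)\<close> then occurs on both
  sides.\<close>

lemma sum_mult_antimono_ge:
  fixes c d :: "nat \<Rightarrow> real"
  assumes "n \<ge> 1" and "antimono_on {1..n} c"
    and "\<And>k. k \<in> {1..n} \<Longrightarrow> 0 \<le> (\<Sum>i=1..k. d i)"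
  shows "c n * (\<Sum>i=1..n. d i) \<le> (\<Sum>i=1..n. c i * d i)"
  using assms
proof (induction n rule: nat_induct_at_least)
  case base
  then show ?case by simp
next
  case (Suc n)
  have "c (Suc n) * (\<Sum>i=1..n. d i) \<le> c n * (\<Sum>i=1..n. d i)"
    using Suc.hyps Suc.prems by (intro mult_right_mono) (auto simp: monotone_on_def)
  also have "\<dots> \<le> (\<Sum>i=1..n. c i * d i)"
    using Suc.prems by (intro Suc.IH) (auto simp: monotone_on_def)
  finally show ?case
    by (simp add: algebra_simps)
qed

text \<open>Tangents are taken at the points \<open>v i\<close>, so their slopes
  \<open>g' (v i)\<close> inherit an order from \<open>v_mono\<close>. Abel summation leaves the
  boundary term \<open>g' (v n)\<close> times the total difference, which is nonnegative because
  \<open>g\<close> is increasing.\<close>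

lemma sum_concave_weak_majorization:
  fixes g g' g'' :: "real \<Rightarrow> real" and u v :: "nat \<Rightarrow> real"
  assumes "n \<ge> 1" and "convex S"
    and g': "\<And>x. x \<in> S \<Longrightarrow> (g has_real_derivative g' x) (at x)"
    and g'': "\<And>x. x \<in> S \<Longrightarrow> (g' has_real_derivative g'' x) (at x)"
    and g'_nonneg: "\<And>x. x \<in> S \<Longrightarrow> g' x \<ge> 0"
    and g''_nonpos: "\<And>x. x \<in> S \<Longrightarrow> g'' x \<le> 0"
    and u: "\<And>i. i \<in> {1..n} \<Longrightarrow> u i \<in> S" and v: "\<And>i. i \<in> {1..n} \<Longrightarrow> v i \<in> S"
    and v_mono: "mono_on {1..n} v"
    and le: "\<And>k. k \<in> {1..n} \<Longrightarrow> (\<Sum>i=1..k. u i) \<le> (\<Sum>i=1..k. v i)"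
  shows "(\<Sum>i=1..n. g (u i)) \<le> (\<Sum>i=1..n. g (v i))"
proof -
  have tangent: "g' y * (y - x) \<le> g y - g x" if "x \<in> S" "y \<in> S" for x y
  proof -
    \<comment> \<open>The library bound is for convex functions, so it is applied to
      \<open>- g\<close>.\<close>
    have "- g' y * (x - y) \<le> - g x - - g y"
      using \<open>convex S\<close> that g''_nonpos
      by (intro f''_imp_f'[where C = S and f'' = "\<lambda>x. - g'' x"]) (auto intro: DERIV_minus g' g'')
    then show ?thesis
      by (simp add: algebra_simps)
  qed
  have "g' y \<le> g' x" if "x \<in> S" "y \<in> S" "x \<le> y" for x y
  proof -
    have "{x..y} \<subseteq> S"
      using closed_segment_subset[OF that(1,2) \<open>convex S\<close>] that(3)
      by (simp add: closed_segment_eq_real_ivl)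
    then show ?thesis
      using g'' g''_nonpos that(3)
      by (intro DERIV_nonpos_imp_nonincreasing[of x y g']) (auto simp: subset_iff intro!: exI)
  qed
  then have "antimono_on {1..n} (\<lambda>i. g' (v i))"
    using v v_mono by (auto simp: monotone_on_def)
  moreover have D: "0 \<le> (\<Sum>i=1..k. v i - u i)" if "k \<in> {1..n}" for k
    using le[OF that] by (simp add: sum_subtractf)
  ultimately have "g' (v n) * (\<Sum>i=1..n. v i - u i) \<le> (\<Sum>i=1..n. g' (v i) * (v i - u i))"
    using \<open>n \<ge> 1\<close> by (intro sum_mult_antimono_ge)
  also have "\<dots> \<le> (\<Sum>i=1..n. g (v i) - g (u i))"
    using tangent u v by (intro sum_mono) auto
  finally have "g' (v n) * (\<Sum>i=1..n. v i - u i) \<le> (\<Sum>i=1..n. g (v i) - g (u i))" .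
  moreover have "0 \<le> g' (v n) * (\<Sum>i=1..n. v i - u i)"
    using D[of n] g'_nonneg[OF v[of n]] \<open>n \<ge> 1\<close> by simp
  ultimately show ?thesis
    by (simp add: sum_subtractf)
qed

text \<open>Identifies the iterates of \<open>deriv\<close> with an explicit family. Openness of
  \<open>S\<close> matters: agreement on \<open>S\<close> is agreement near each of its points, so
  derivatives carry over.\<close>

lemma higher_deriv_unique:
  fixes G :: "nat \<Rightarrow> 'a::real_normed_field \<Rightarrow> 'a"
  assumes "open S" and G: "\<And>k x. x \<in> S \<Longrightarrow> (G k has_field_derivative G (Suc k) x) (at x)"
    and "x \<in> S"
  shows "(deriv ^^ k) (G 0) x = G k x"
    and "((deriv ^^ k) (G 0) has_field_derivative G (Suc k) x) (at x)"
proof -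
  have *: "\<forall>x\<in>S. (deriv ^^ k) (G 0) x = G k x" for k
  proof (induction k)
    case (Suc k)
    show ?case
    proof
      fix x assume "x \<in> S"
      then have "((deriv ^^ k) (G 0) has_field_derivative G (Suc k) x) (at x)"
        using Suc by (intro has_field_derivative_transform_within_open[OF G \<open>open S\<close>]) auto
      then show "(deriv ^^ Suc k) (G 0) x = G (Suc k) x"
        by (simp add: DERIV_imp_deriv)
    qed
  qed simp
  then show "(deriv ^^ k) (G 0) x = G k x"
    using \<open>x \<in> S\<close> by blast
  show "((deriv ^^ k) (G 0) has_field_derivative G (Suc k) x) (at x)"
    using * \<open>x \<in> S\<close> by (intro has_field_derivative_transform_within_open[OF G \<open>open S\<close>]) auto
qed

theorem theorem3p1:
  fixes n :: nat and a b :: "nat \<Rightarrow> real" and f :: "real \<Rightarrow> real"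
  assumes "n \<ge> 1"
    and "0 \<le> a 1" and "mono_on {1..n} a"
    and "0 \<le> b 1" and "mono_on {1..n} b"
    and "\<And>k. k \<in> {1..n} \<Longrightarrow> (\<Sum>i=1..k. a i) \<le> (\<Sum>i=1..k. b i)"
    and "\<And>x. x \<in> {0<..} \<Longrightarrow> f differentiable (at x)"
    and "\<And>x. x \<in> {0<..} \<Longrightarrow> deriv f differentiable (at x)"
    and "completely_monotonic_on {0<..} (deriv (deriv f))"
  shows "log_completely_monotonic_on {0<..}
           (\<lambda>x. exp (\<Sum>i=1..n. f (x + a i) - f (x + b i)))"
proof -
  define F where "F k = (deriv ^^ k) f" for k
  have F_add2: "(deriv ^^ k) (deriv (deriv f)) = F (Suc (Suc k))" for k
    by (simp add: F_def funpow_swap1)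
  have F_sign: "0 \<le> (- 1) ^ k * F (Suc (Suc k)) x" if "x > 0" for k x
    using assms(9) that by (auto simp: completely_monotonic_on_def F_add2)
  have "F k differentiable (at x)" if "x > 0" for k x
  proof -
    \<comment> \<open>Complete monotonicity of \<open>f''\<close> covers only orders from 2 on;
      orders 0 and 1 have their own hypotheses.\<close>
    consider "k = 0" | "k = 1" | j where "k = Suc (Suc j)"
      by (metis One_nat_def not0_implies_Suc)
    then show ?thesis
    proof cases
      case 3
      then show ?thesis
        using assms(9) that by (auto simp: completely_monotonic_on_def F_add2)
    qed (use assms(7,8) that in \<open>auto simp: F_def\<close>)
  qed
  then have F_deriv: "(F k has_real_derivative F (Suc k) x) (at x)" if "x > 0" for k x
    using that by (simp add: F_def DERIV_deriv_iff_real_differentiable)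

  \<comment> \<open>This keeps the shifted points \<open>x + a i\<close> and \<open>x + b i\<close>
    inside the domain of \<open>f\<close>.\<close>
  have a: "0 \<le> a i" and b: "0 \<le> b i" if "i \<in> {1..n}" for i
    using monotone_onD[OF assms(3), of 1 i] monotone_onD[OF assms(5), of 1 i] assms(1,2,4) that
    by auto
  \<comment> \<open>\<open>H 0\<close> is the witness \<open>h\<close> in
    \<open>exp (- h x)\<close>, whence the order \<open>b\<close> minus \<open>a\<close>;
    \<open>H k\<close> will be its derivative of order \<open>k\<close>.\<close>
  define H where "H k x = (\<Sum>i=1..n. F k (x + b i) - F k (x + a i))" for k x
  have H_deriv: "(H k has_real_derivative H (Suc k) x) (at x)" if "x \<in> {0<..}" for k x
    unfolding H_def [abs_def]
  proof (intro DERIV_sum DERIV_diff)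
    fix i assume "i \<in> {1..n}"
    then show "((\<lambda>x. F k (x + b i)) has_real_derivative F (Suc k) (x + b i)) (at x)"
      and "((\<lambda>x. F k (x + a i)) has_real_derivative F (Suc k) (x + a i)) (at x)"
      using a[of i] b[of i] that by (auto simp flip: DERIV_shift intro!: F_deriv)
  qed
  have H_sign: "0 \<le> (- 1) ^ k * H (Suc k) x" if "x > 0" for k x
  proof -
    have "(\<Sum>i=1..n. (- 1) ^ k * F (Suc k) (x + a i)) \<le> (\<Sum>i=1..n. (- 1) ^ k * F (Suc k) (x + b i))"
    proof (rule sum_concave_weak_majorization[where S = "{0<..}" and g = "\<lambda>y. (- 1) ^ k * F (Suc k) y"
          and g' = "\<lambda>y. (- 1) ^ k * F (Suc (Suc k)) y"
          and g'' = "\<lambda>y. (- 1) ^ k * F (Suc (Suc (Suc k))) y"])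
      show "mono_on {1..n} (\<lambda>i. x + b i)"
        using assms(5) by (simp add: monotone_on_def)
      \<comment> \<open>Concavity: the order of \<open>F\<close> is one higher than for
        \<open>g'\<close> while the sign factor stays the same, so \<open>F_sign\<close> at
        \<open>Suc k\<close> yields the opposite sign.\<close>
      show "(- 1) ^ k * F (Suc (Suc (Suc k))) y \<le> 0" if "y \<in> {0<..}" for y
        using F_sign[of y "Suc k"] that by simp
    qed (use assms(1,6) that in
        \<open>auto simp: sum.distrib intro!: F_sign DERIV_cmult F_deriv add_pos_nonneg a b\<close>)
    then show ?thesis
      by (simp add: H_def sum_distrib_left right_diff_distrib sum_subtractf)
  qed

  have H_iter: "(deriv ^^ k) (deriv (H 0)) = (deriv ^^ Suc k) (H 0)" for k
    by (simp add: funpow_swap1)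
  have "completely_monotonic_on {0<..} (deriv (H 0))"
    unfolding completely_monotonic_on_def H_iter
  proof (intro conjI allI ballI)
    fix k :: nat and x :: real
    assume x: "x \<in> {0<..}"
    have iter: "(deriv ^^ Suc k) (H 0) x = H (Suc k) x"
      "((deriv ^^ Suc k) (H 0) has_real_derivative H (Suc (Suc k)) x) (at x)"
      using H_deriv x by (intro higher_deriv_unique[of "{0<..}" H] open_greaterThan; blast)+
    show "(deriv ^^ Suc k) (H 0) differentiable (at x)"
      using iter(2) unfolding real_differentiable_def by blast
    show "0 \<le> (- 1) ^ k * (deriv ^^ Suc k) (H 0) x"
      using H_sign x unfolding iter(1) by simp
  qed
  moreover have "H 0 differentiable (at x)" if "x \<in> {0<..}" for x
    using H_deriv[OF that] by (auto simp: real_differentiable_def)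
  moreover have "(\<Sum>i=1..n. f (x + a i) - f (x + b i)) = - H 0 x" for x
    by (simp add: H_def F_def flip: sum_negf)
  ultimately show ?thesis
    unfolding log_completely_monotonic_on_def by (auto intro!: exI[of _ "H 0"])
qed

end
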